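(* The category of orientals $\mathcal{O}$ is the closure of the subcategory of simplexes $\Delta$ under the filler operations $\bigtriangledown_i$ and composition. That is, the family of sets $\mathcal{O}(m,n)$ ($m,n\ge0$) is the smallest family of subsets $S(m,n)\subseteq\mathbf{Z}\Delta(m,n)$ such that $\Delta(m,n)\subseteq S(m,n)$ for all $m,n$; $g\circ f\in S(l,n)$ whenever $f\in S(l,m)$ and $g\in S(m,n)$; and $x\bigtriangledown_i y\in S(m+1,n)$ whenever $x,y\in S(m,n)$, $0\le i\le m-1$ and $\partial_i x=\partial_{i+1}y$.
   Context: The objects of the simplex category $\Delta$ are the integers $0,1,2,\dots$; $\Delta(m,n)$ is the set of non-decreasing functions $f\colon\{0,\dots,m\}\to\{0,\dots,n\}$, written as tuples $(f_0,\dots,f_m)$ with $0\le f_0\le\dots\le f_m\le n$, with the usual composition. $\mathbf{Z}\Delta$ is the category with the same objects in which $\mathbf{Z}\Delta(m,n)$ is the free abelian group with basis $\Delta(m,n)$; composition is extended bilinearly. $\mathcal{O}(m,n)\subseteq\mathbf{Z}\Delta(m,n)$ is the set of linear combinations $x$ such that (1) the sum of the coefficients in $x$ is $1$; (2) for all injective morphisms $f$ in $\Delta$ with codomain $m$, the coefficients of the injective morphisms in $x\circ f$ are nonnegative. The category of orientals $\mathcal{O}$ is the subcategory of $\mathbf{Z}\Delta$ with these morphism sets (it is isomorphic to the category of Street's orientals $\mathcal{O}_0,\mathcal{O}_1,\dots$); it contains $\Delta$. Face operations $\partial_i\colon\mathbf{Z}\Delta(m,n)\to\mathbf{Z}\Delta(m-1,n)$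 ($m>0$, $0\le i\le m$): $\partial_i x=x\circ(0,\dots,i-1,i+1,\dots,m)$. Degeneracy operations $\epsilon_i\colon\mathbf{Z}\Delta(m,n)\to\mathbf{Z}\Delta(m+1,n)$ ($0\le i\le m$): $\epsilon_i x=x\circ(0,\dots,i-1,i,i,i+1,\dots,m)$. Filler operations: if $x,y\in\mathbf{Z}\Delta(m,n)$ and $\partial_i x=\partial_{i+1}y$ for some $i$ with $0\le i\le m-1$, then $x\bigtriangledown_i y=\epsilon_{i+1}x-\epsilon_i\epsilon_i\partial_i x+\epsilon_i y\in\mathbf{Z}\Delta(m+1,n)$. *)

theory Defs
  imports "HOL-Algebra.Free_Abelian_Groups"
begin

text \<open>
  A morphism of the simplex category is represented by the tuple of its values. The list does not
  record the codomain, so the same list lies in \<open>Delta m n\<close> for all sufficiently large \<open>n\<close>; hence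
  families of morphism sets are indexed explicitly by source and target. For such a list,
  injectivity of the morphism is \<^term>\<open>distinct\<close>.
\<close>

definition Delta :: "nat \<Rightarrow> nat \<Rightarrow> nat list set" where
  "Delta m n = {f. length f = m + 1 \<and> sorted f \<and> set f \<subseteq> {0..n}}"

definition simplex_comp :: "nat list \<Rightarrow> nat list \<Rightarrow> nat list" where
  "simplex_comp g f = map (\<lambda>i. g ! i) f"

definition ZDelta :: "nat \<Rightarrow> nat \<Rightarrow> (nat list \<Rightarrow>\<^sub>0 int) set" where
  "ZDelta m n = carrier (free_Abelian_group (Delta m n))"

definition zcomp :: "(nat list \<Rightarrow>\<^sub>0 int) \<Rightarrow> (nat list \<Rightarrow>\<^sub>0 int) \<Rightarrow> (nat list \<Rightarrow>\<^sub>0 int)"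
    (infixl "\<circ>\<^sub>Z" 70) where
  "y \<circ>\<^sub>Z x = frag_extend (\<lambda>g. frag_extend (\<lambda>f. frag_of (simplex_comp g f)) x) y"

definition coeff_sum :: "(nat list \<Rightarrow>\<^sub>0 int) \<Rightarrow> int" where
  "coeff_sum x = (\<Sum>f\<in>Poly_Mapping.keys x. Poly_Mapping.lookup x f)"

definition Orient :: "nat \<Rightarrow> nat \<Rightarrow> (nat list \<Rightarrow>\<^sub>0 int) set" where
  "Orient m n = {x \<in> ZDelta m n. coeff_sum x = 1 \<and>
     (\<forall>l. \<forall>f \<in> Delta l m. distinct f \<longrightarrow>
        (\<forall>g \<in> Delta l n. distinct g \<longrightarrow> Poly_Mapping.lookup (x \<circ>\<^sub>Z frag_of f) g \<ge> 0))}"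

text \<open>
  In the following operations \<open>m\<close> is the source of the argument \<open>x\<close>, which cannot be
  recovered from \<open>x\<close> when \<open>x = 0\<close>. The face operation is meant for \<open>m > 0\<close> and \<open>i \<le> m\<close>, the
  degeneracy for \<open>i \<le> m\<close>, and the filler for \<open>i < m\<close>.
\<close>

definition face :: "nat \<Rightarrow> nat \<Rightarrow> (nat list \<Rightarrow>\<^sub>0 int) \<Rightarrow> (nat list \<Rightarrow>\<^sub>0 int)" where
  "face m i x = x \<circ>\<^sub>Z frag_of ([0..<i] @ [i + 1..<m + 1])"

definition degen :: "nat \<Rightarrow> nat \<Rightarrow> (nat list \<Rightarrow>\<^sub>0 int) \<Rightarrow> (nat list \<Rightarrow>\<^sub>0 int)" where
  "degen m i x = x \<circ>\<^sub>Z frag_of ([0..<i + 1] @ [i..<m + 1])"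

definition filler ::
    "nat \<Rightarrow> nat \<Rightarrow> (nat list \<Rightarrow>\<^sub>0 int) \<Rightarrow> (nat list \<Rightarrow>\<^sub>0 int) \<Rightarrow> (nat list \<Rightarrow>\<^sub>0 int)" where
  "filler m i x y =
     degen m (i + 1) x - degen m i (degen (m - 1) i (face m i x)) + degen m i y"

definition closed_family :: "(nat \<Rightarrow> nat \<Rightarrow> (nat list \<Rightarrow>\<^sub>0 int) set) \<Rightarrow> bool" where
  "closed_family S \<longleftrightarrow>
     (\<forall>m n. S m n \<subseteq> ZDelta m n) \<and>
     (\<forall>m n. frag_of ` Delta m n \<subseteq> S m n) \<and>
     (\<forall>l m n. \<forall>f \<in> S l m. \<forall>g \<in> S m n. g \<circ>\<^sub>Z f \<in> S l n) \<and>
     (\<forall>m n i. \<forall>x \<in> S m n. \<forall>y \<in> S m n.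
        i < m \<longrightarrow> face m i x = face m (i + 1) y \<longrightarrow> filler m i x y \<in> S (m + 1) n)"

end

theory Submission imports Defs begin

text \<open>
  Closure of the orientals under composition holds because a degenerate tuple composed with
  anything is degenerate, so the matrix of coefficients at injective morphisms is multiplicative.

  For generation, split \<open>x \<in> \<O>(m,n)\<close> as \<open>x = c + d\<close>, where \<open>c\<close> consists of the
  terms of \<open>x\<close> with last entry \<open>n\<close>. The part \<open>c\<close> is again nonnegative. If its coefficient
  sum is \<open>0\<close> then \<open>c = 0\<close>, and \<open>x\<close> comes from \<open>\<O>(m,n-1)\<close>; otherwise the sum is \<open>1\<close>
  and \<open>c\<close> is the cone on an element of \<open>\<O>(m-1,n)\<close>. If the terms of \<open>c\<close> are constant on the
  positions \<open>t,\<dots>,m\<close>, then fillers build \<open>x\<close> from \<open>c\<close>, elements of \<open>\<O>(m-1,n)\<close> and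
  \<open>w = d + c \<circ> (0,\<dots>,t-1,t-1,t+1,\<dots>,m)\<close>, whose top part is more degenerate.
\<close>

section \<open>Linear functionals and simplicial operators on tuples\<close>

text \<open>One family of linear functionals covers single coefficients, coefficient sums and
  coefficients of composites. Operators induced by maps of tuples act on it by pulling back
  \<open>P\<close>, so many identities reduce to equivalences of predicates.\<close>

definition weight :: "('a \<Rightarrow> bool) \<Rightarrow> ('a \<Rightarrow>\<^sub>0 int) \<Rightarrow> int" where
  "weight P x = (\<Sum>a \<in> Poly_Mapping.keys x. if P a then Poly_Mapping.lookup x a else 0)"

lemma weight_superset:
  assumes "finite A" "Poly_Mapping.keys x \<subseteq> A"
  shows "weight P x = (\<Sum>a\<in>A. if P a then Poly_Mapping.lookup x a else 0)"
  unfolding weight_def using assms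
  by (intro sum.mono_neutral_left) (auto simp: in_keys_iff)

lemma weight_diff: "weight P (x - y) = weight P x - weight P y"
proof -
  let ?A = "Poly_Mapping.keys x \<union> Poly_Mapping.keys y"
  have "Poly_Mapping.keys (x - y) \<subseteq> ?A" by (rule keys_diff)
  then have "weight P (x - y) = (\<Sum>a\<in>?A. if P a then Poly_Mapping.lookup (x - y) a else 0)"
    by (intro weight_superset) auto
  also have "\<dots> = (\<Sum>a\<in>?A. if P a then Poly_Mapping.lookup x a else 0)
      - (\<Sum>a\<in>?A. if P a then Poly_Mapping.lookup y a else 0)"
    unfolding sum_subtractf[symmetric] by (rule sum.cong) (auto simp: lookup_minus)
  also have "\<dots> = weight P x - weight P y"
    by (subst (1 2) weight_superset[where A = ?A]) auto
  finally show ?thesis .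
qed

lemma weight_zero [simp]: "weight P 0 = 0"
  by (simp add: weight_def)

lemma weight_add: "weight P (x + y) = weight P x + weight P y"
  using weight_diff[of P x "0 - y"] weight_diff[of P 0 y] by simp

lemma weight_frag_of [simp]: "weight P (frag_of a) = (if P a then 1 else 0)"
  by (simp add: weight_def)

lemma weight_cong:
  "(\<And>a. a \<in> Poly_Mapping.keys x \<Longrightarrow> P a = Q a) \<Longrightarrow> weight P x = weight Q x"
  unfolding weight_def by (intro sum.cong) auto

lemma weight_eq_0:
  "(\<And>a. a \<in> Poly_Mapping.keys x \<Longrightarrow> \<not> P a) \<Longrightarrow> weight P x = 0"
  unfolding weight_def by (intro sum.neutral) auto

lemma lookup_eq_weight: "Poly_Mapping.lookup x a = weight (\<lambda>b. b = a) x"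
proof -
  have "weight (\<lambda>b. b = a) x = (\<Sum>b \<in> insert a (Poly_Mapping.keys x).
      if b = a then Poly_Mapping.lookup x b else 0)"
    by (intro weight_superset) auto
  then show ?thesis by simp
qed

lemma coeff_sum_eq_weight: "coeff_sum x = weight (\<lambda>_. True) x"
  by (simp add: coeff_sum_def weight_def)

lemma weight_frag_extend_of:
  "weight P (frag_extend (\<lambda>a. frag_of (h a)) x) = weight (\<lambda>a. P (h a)) x"
  using subset_UNIV[of "Poly_Mapping.keys x"]
  by (induction x rule: frag_induction) (auto simp: frag_extend_diff weight_diff)

section \<open>Bilinearity of composition\<close>

lemma sum_coeff_diff:
  fixes \<phi> :: "'a \<Rightarrow> int"
  shows "(\<Sum>a\<in>Poly_Mapping.keys (x - y). Poly_Mapping.lookup (x - y) a * \<phi> a) =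
    (\<Sum>a\<in>Poly_Mapping.keys x. Poly_Mapping.lookup x a * \<phi> a)
    - (\<Sum>a\<in>Poly_Mapping.keys y. Poly_Mapping.lookup y a * \<phi> a)"
proof -
  let ?A = "Poly_Mapping.keys x \<union> Poly_Mapping.keys y"
  have *: "(\<Sum>a\<in>Poly_Mapping.keys z. Poly_Mapping.lookup z a * \<phi> a)
      = (\<Sum>a\<in>?A. Poly_Mapping.lookup z a * \<phi> a)" if "Poly_Mapping.keys z \<subseteq> ?A" for z
    using that by (intro sum.mono_neutral_left) (auto simp: in_keys_iff)
  have "Poly_Mapping.keys (x - y) \<subseteq> ?A" by (rule keys_diff)
  then show ?thesis
    by (subst (1 2 3) *) (auto simp: sum_subtractf[symmetric] lookup_minus algebra_simps)
qed

lemma weight_zcomp: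
  "weight P (y \<circ>\<^sub>Z x) = (\<Sum>f\<in>Poly_Mapping.keys x.
     Poly_Mapping.lookup x f * weight (\<lambda>g. P (simplex_comp g f)) y)"
  using subset_UNIV[of "Poly_Mapping.keys y"]
proof (induction y rule: frag_induction)
  case (one g)
  show ?case
    by (simp add: zcomp_def weight_frag_extend_of) (simp add: weight_def if_distrib cong: if_cong)
next
  case (diff a b)
  then show ?case
    by (simp add: zcomp_def frag_extend_diff weight_diff right_diff_distrib sum_subtractf)
qed (simp add: zcomp_def)

lemma zcomp_diff_left: "(y - y') \<circ>\<^sub>Z x = y \<circ>\<^sub>Z x - y' \<circ>\<^sub>Z x"
  by (simp add: zcomp_def frag_extend_diff)

lemma zcomp_zero_left [simp]: "0 \<circ>\<^sub>Z x = 0"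
  by (simp add: zcomp_def)

text \<open>Linearity in the outer factor is built into \<open>frag_extend\<close>. In the inner
  factor it is read off coefficientwise, because \<open>weight_zcomp\<close> is a sum weighted by
  the coefficients of that factor.\<close>

lemma zcomp_diff_right: "y \<circ>\<^sub>Z (x - x') = y \<circ>\<^sub>Z x - y \<circ>\<^sub>Z x'"
  by (rule poly_mapping_eqI)
     (simp only: lookup_eq_weight[of "_ \<circ>\<^sub>Z _"] lookup_eq_weight[of "_ - _ \<circ>\<^sub>Z _"]
        weight_diff weight_zcomp sum_coeff_diff)

lemma zcomp_zero_right [simp]: "y \<circ>\<^sub>Z 0 = 0"
  using zcomp_diff_right[of y 0 0] by simp

lemma zcomp_frag_of: "y \<circ>\<^sub>Z frag_of f = frag_extend (\<lambda>g. frag_of (simplex_comp g f)) y"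
  by (simp add: zcomp_def)

lemma zcomp_frag_of_frag_of [simp]:
  "frag_of g \<circ>\<^sub>Z frag_of f = frag_of (simplex_comp g f)"
  by (simp add: zcomp_def)

lemma lookup_zcomp_frag_of:
  "Poly_Mapping.lookup (x \<circ>\<^sub>Z frag_of f) g = weight (\<lambda>a. simplex_comp a f = g) x"
  by (simp add: lookup_eq_weight zcomp_frag_of weight_frag_extend_of)

section \<open>Morphism sets, tuples and their composites\<close>

lemma ZDelta_iff: "x \<in> ZDelta m n \<longleftrightarrow> Poly_Mapping.keys x \<subseteq> Delta m n"
  by (simp add: ZDelta_def)

lemma ZDelta_diff: "x \<in> ZDelta m n \<Longrightarrow> y \<in> ZDelta m n \<Longrightarrow> x - y \<in> ZDelta m n"
  unfolding ZDelta_iff using keys_diff[of x y] by blast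

lemma ZDelta_add: "x \<in> ZDelta m n \<Longrightarrow> y \<in> ZDelta m n \<Longrightarrow> x + y \<in> ZDelta m n"
  unfolding ZDelta_iff using keys_add[of x y] by blast

lemma ZDelta_frag_extend:
  assumes "x \<in> ZDelta m n" "\<And>a. a \<in> Delta m n \<Longrightarrow> h a \<in> ZDelta m' n'"
  shows "frag_extend h x \<in> ZDelta m' n'"
  using assms keys_frag_extend[of h x] unfolding ZDelta_iff by blast

lemma ZDelta_induct [consumes 1, case_names zero one diff]:
  assumes "x \<in> ZDelta m n" "P 0" "\<And>f. f \<in> Delta m n \<Longrightarrow> P (frag_of f)"
    "\<And>a b. P a \<Longrightarrow> P b \<Longrightarrow> P (a - b)"
  shows "P x"
  using assms(1)[unfolded ZDelta_iff] assms(2-) by (rule frag_induction)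

lemma frag_of_in_ZDelta: "f \<in> Delta m n \<Longrightarrow> frag_of f \<in> ZDelta m n"
  by (simp add: ZDelta_iff)

lemma Delta_iff_nth:
  "f \<in> Delta m n \<longleftrightarrow> length f = Suc m \<and> (\<forall>i j. i \<le> j \<longrightarrow> j \<le> m \<longrightarrow> f ! i \<le> f ! j) \<and> f ! m \<le> n"
proof (cases "length f = Suc m")
  case True
  then have "set f \<subseteq> {0..n} \<longleftrightarrow> (\<forall>i\<le>m. f ! i \<le> n)"
    by (fastforce simp: in_set_conv_nth less_Suc_eq_le)
  moreover have "sorted f \<longleftrightarrow> (\<forall>i j. i \<le> j \<longrightarrow> j \<le> m \<longrightarrow> f ! i \<le> f ! j)"
    using True by (auto simp: sorted_iff_nth_mono less_Suc_eq_le)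
  ultimately show ?thesis
    unfolding Delta_def using True by (auto intro: order_trans)
qed (simp add: Delta_def)

lemma Delta_last: "f \<in> Delta m n \<Longrightarrow> last f = f ! m"
  by (cases f rule: rev_cases) (auto simp: Delta_iff_nth)

lemma Delta_nth_le: "f \<in> Delta m n \<Longrightarrow> i \<le> m \<Longrightarrow> f ! i \<le> n"
  unfolding Delta_iff_nth by (meson le_refl order_trans)

lemma Delta_nth_mono: "f \<in> Delta m n \<Longrightarrow> i \<le> j \<Longrightarrow> j \<le> m \<Longrightarrow> f ! i \<le> f ! j"
  unfolding Delta_iff_nth by blast

lemma Delta_mem_le: "f \<in> Delta m n \<Longrightarrow> i \<in> set f \<Longrightarrow> i \<le> n"
  by (auto simp: Delta_def)

lemma Delta_length: "f \<in> Delta m n \<Longrightarrow> length f = Suc m"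
  by (simp add: Delta_def)

lemma Delta_mono: "n \<le> n' \<Longrightarrow> Delta m n \<subseteq> Delta m n'"
  by (auto simp: Delta_def)

lemma simplex_comp_in_Delta:
  assumes "g \<in> Delta m n" "f \<in> Delta l m" shows "simplex_comp g f \<in> Delta l n"
  using assms Delta_nth_le[OF assms(1)] Delta_nth_mono[OF assms(1)] Delta_nth_le[OF assms(2)]
    Delta_nth_mono[OF assms(2)]
  by (auto simp: simplex_comp_def Delta_iff_nth)

lemma simplex_comp_assoc:
  assumes "f \<in> Delta l m" "h \<in> Delta k l"
  shows "simplex_comp (simplex_comp g f) h = simplex_comp g (simplex_comp f h)"
  using assms by (auto simp: simplex_comp_def Delta_def)

lemma zcomp_in_ZDelta:
  assumes "y \<in> ZDelta m n" "x \<in> ZDelta l m" shows "y \<circ>\<^sub>Z x \<in> ZDelta l n"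
  unfolding zcomp_def
  using assms by (intro ZDelta_frag_extend frag_of_in_ZDelta simplex_comp_in_Delta)

text \<open>A basis element as innermost factor is enough, since nonnegativity only tests composites
  with basis elements.\<close>

lemma zcomp_assoc:
  assumes "y \<in> ZDelta m n" "x \<in> ZDelta l m" "f \<in> Delta k l"
  shows "(y \<circ>\<^sub>Z x) \<circ>\<^sub>Z frag_of f = y \<circ>\<^sub>Z (x \<circ>\<^sub>Z frag_of f)"
  using assms(2)
proof (induction x rule: ZDelta_induct)
  case (one h)
  from assms(1) show ?case
    by (induction y rule: ZDelta_induct)
       (use one assms(3) in \<open>auto simp: simplex_comp_assoc zcomp_diff_left\<close>)
qed (simp_all add: zcomp_diff_left zcomp_diff_right)

text \<open>Precomposition with the tuple of values of \<open>\<phi>\<close> on 0, ...,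
  \<open>l\<close>. Working with vertex maps instead of tuples lets simplicial identities be checked
  pointwise.\<close>

definition act :: "nat \<Rightarrow> (nat \<Rightarrow> nat) \<Rightarrow> (nat list \<Rightarrow>\<^sub>0 int) \<Rightarrow> (nat list \<Rightarrow>\<^sub>0 int)" where
  "act l \<phi> x = frag_extend (\<lambda>a. frag_of (map (\<lambda>i. a ! \<phi> i) [0..<Suc l])) x"

lemma act_eq_zcomp: "act l \<phi> x = x \<circ>\<^sub>Z frag_of (map \<phi> [0..<Suc l])"
  by (simp add: act_def zcomp_frag_of simplex_comp_def comp_def del: upt_Suc)

lemma act_diff: "act l \<phi> (x - y) = act l \<phi> x - act l \<phi> y"
  by (simp add: act_def frag_extend_diff)

lemma act_add: "act l \<phi> (x + y) = act l \<phi> x + act l \<phi> y"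
  by (simp add: act_def frag_extend_add)

lemma act_zero [simp]: "act l \<phi> 0 = 0"
  by (simp add: act_def)

lemma act_cong: "(\<And>i. i \<le> l \<Longrightarrow> \<phi> i = \<psi> i) \<Longrightarrow> act l \<phi> x = act l \<psi> x"
  unfolding act_def by (intro frag_extend_eq) (auto simp: frag_of_eq)

lemma weight_act: "weight P (act l \<phi> x) = weight (\<lambda>a. P (map (\<lambda>i. a ! \<phi> i) [0..<Suc l])) x"
  by (simp add: act_def weight_frag_extend_of)

lemma act_act:
  assumes "\<And>i. i \<le> k \<Longrightarrow> \<chi> i \<le> l"
  shows "act k \<chi> (act l \<psi> x) = act k (\<lambda>i. \<psi> (\<chi> i)) x"
proof -
  have *: "map (\<lambda>i. map (\<lambda>i. a ! \<psi> i) [0..<Suc l] ! \<chi> i) [0..<Suc k]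
      = map (\<lambda>i. a ! \<psi> (\<chi> i)) [0..<Suc k]" for a :: "nat list"
    using assms by (intro map_cong) (auto simp: less_Suc_eq_le nth_append simp del: upt_Suc)
  show ?thesis
    using frag_extend_compose[of "\<lambda>a. frag_of (map (\<lambda>i. a ! \<chi> i) [0..<Suc k])"
        "\<lambda>a. map (\<lambda>i. a ! \<psi> i) [0..<Suc l]" x]
    unfolding act_def comp_def * .
qed

lemma act_id:
  assumes "x \<in> ZDelta m n" shows "act m (\<lambda>i. i) x = x"
proof -
  have "act m (\<lambda>i. i) x = frag_extend frag_of x"
    unfolding act_def
  proof (rule frag_extend_eq)
    fix a assume "a \<in> Poly_Mapping.keys x"
    then have "length a = Suc m" using assms by (auto simp: ZDelta_iff Delta_def)
    then show "frag_of (map (\<lambda>i. a ! i) [0..<Suc m]) = frag_of a"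
      by (metis map_nth)
  qed
  then show ?thesis by (simp flip: frag_expansion)
qed

lemma map_upt_in_Delta:
  assumes "mono \<phi>" "\<phi> l \<le> m" shows "map \<phi> [0..<Suc l] \<in> Delta l m"
  using assms by (auto simp: Delta_iff_nth monoD simp del: upt_Suc)

lemma act_in_ZDelta:
  assumes "x \<in> ZDelta m n" "mono \<phi>" "\<phi> l \<le> m" shows "act l \<phi> x \<in> ZDelta l n"
  unfolding act_eq_zcomp
  using assms by (intro zcomp_in_ZDelta frag_of_in_ZDelta map_upt_in_Delta)

lemma keys_act:
  "Poly_Mapping.keys (act l \<phi> x) \<subseteq> (\<lambda>a. map (\<lambda>i. a ! \<phi> i) [0..<Suc l]) ` Poly_Mapping.keys x"
  using keys_frag_extend[of "\<lambda>a. frag_of (map (\<lambda>i. a ! \<phi> i) [0..<Suc l])" x]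
  unfolding act_def keys_frag_of by blast

text \<open>The coface map that omits the vertex \<open>i\<close>.\<close>

definition skip :: "nat \<Rightarrow> nat \<Rightarrow> nat" where
  "skip i k = (if k < i then k else Suc k)"

text \<open>The codegeneracy map that takes the value \<open>i\<close> twice.\<close>

definition dup :: "nat \<Rightarrow> nat \<Rightarrow> nat" where
  "dup i k = (if k \<le> i then k else k - 1)"

lemma mono_skip: "mono (skip i)" and mono_dup: "mono (dup i)"
  by (auto simp: mono_def skip_def dup_def)

lemma face_eq_act:
  assumes "i \<le> Suc m" shows "face (Suc m) i x = act m (skip i) x"
proof -
  have "[0..<i] @ [i + 1..<Suc m + 1] = map (skip i) [0..<Suc m]"
    using assms by (intro nth_equalityI) (auto simp: nth_append skip_def simp del: upt_Suc)
  then show ?thesis by (simp add: face_def act_eq_zcomp)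
qed

lemma degen_eq_act:
  assumes "i \<le> m" shows "degen m i x = act (Suc m) (dup i) x"
proof -
  have "[0..<i + 1] @ [i..<m + 1] = map (dup i) [0..<Suc (Suc m)]"
    using assms by (intro nth_equalityI) (auto simp: nth_append dup_def simp del: upt_Suc)
  then show ?thesis by (simp add: degen_def act_eq_zcomp)
qed

lemma filler_eq_act:
  assumes "i < Suc m"
  shows "filler (Suc m) i x y = act (Suc (Suc m)) (dup (Suc i)) x
     - act (Suc (Suc m)) (\<lambda>k. skip i (dup i (dup i k))) x + act (Suc (Suc m)) (dup i) y"
  using assms
  by (simp add: filler_def face_eq_act degen_eq_act) (subst act_act | force simp: dup_def)+

section \<open>The orientals are closed\<close>

lemma coeff_sum_diff: "coeff_sum (x - y) = coeff_sum x - coeff_sum y"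
  and coeff_sum_add: "coeff_sum (x + y) = coeff_sum x + coeff_sum y"
  and coeff_sum_act: "coeff_sum (act l \<phi> x) = coeff_sum x"
  and coeff_sum_frag_of: "coeff_sum (frag_of f) = 1"
  and coeff_sum_zero: "coeff_sum 0 = 0"
  by (simp_all add: coeff_sum_eq_weight weight_diff weight_add weight_act)

lemma coeff_sum_zcomp: "coeff_sum (y \<circ>\<^sub>Z x) = coeff_sum x * coeff_sum y"
  unfolding coeff_sum_eq_weight weight_zcomp
  by (simp add: weight_def flip: sum_distrib_right)

text \<open>Condition (2) on its own, so that it also applies to elements whose coefficient sum is
  not 1, such as top parts.\<close>

definition nonneg :: "nat \<Rightarrow> nat \<Rightarrow> (nat list \<Rightarrow>\<^sub>0 int) \<Rightarrow> bool" where
  "nonneg m n x \<longleftrightarrow> (\<forall>l. \<forall>f \<in> Delta l m. distinct f \<longrightarrow>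
     (\<forall>g \<in> Delta l n. distinct g \<longrightarrow> 0 \<le> weight (\<lambda>a. simplex_comp a f = g) x))"

lemma Orient_iff:
  "x \<in> Orient m n \<longleftrightarrow> x \<in> ZDelta m n \<and> coeff_sum x = 1 \<and> nonneg m n x"
  by (simp add: Orient_def nonneg_def lookup_zcomp_frag_of)

lemma weight_comp_not_distinct:
  assumes "\<not> distinct f" "distinct g"
  shows "weight (\<lambda>a. simplex_comp a f = g) x = 0"
  by (rule weight_eq_0) (use assms in \<open>auto simp: simplex_comp_def distinct_map\<close>)

text \<open>Injectivity of \<open>f\<close> may be dropped: if \<open>f\<close> repeats a vertex, so
  does every composite with it, and the coefficient at an injective \<open>g\<close> is 0. This
  makes nonnegativity stable under all monotone vertex maps.\<close>

lemma nonneg_weight: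
  assumes "nonneg m n x" "f \<in> Delta l m" "g \<in> Delta l n" "distinct g"
  shows "0 \<le> weight (\<lambda>a. simplex_comp a f = g) x"
  using assms weight_comp_not_distinct[of f g x] unfolding nonneg_def
  by (cases "distinct f") auto

lemma map_in_Delta:
  assumes "mono \<phi>" "\<phi> l \<le> m" "f \<in> Delta k l" shows "map \<phi> f \<in> Delta k m"
proof -
  have "\<phi> (f ! k) \<le> \<phi> l" using assms(1,3) by (intro monoD[of \<phi>]) (auto simp: Delta_nth_le)
  moreover have "\<phi> (f ! i) \<le> \<phi> (f ! j)" if "i \<le> j" "j \<le> k" for i j
    using assms(1) Delta_nth_mono[OF assms(3) that] by (rule monoD)
  ultimately show ?thesis
    using assms(2) Delta_length[OF assms(3)] by (auto simp: Delta_iff_nth[of "map \<phi> f"])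
qed

lemma weight_comp_act:
  assumes "f \<in> Delta k l"
  shows "weight (\<lambda>a. simplex_comp a f = g) (act l \<phi> x) = weight (\<lambda>a. simplex_comp a (map \<phi> f) = g) x"
proof -
  have "simplex_comp (map (\<lambda>i. a ! \<phi> i) [0..<Suc l]) f = simplex_comp a (map \<phi> f)" for a
    using Delta_mem_le[OF assms] by (auto simp: simplex_comp_def less_Suc_eq_le simp del: upt_Suc)
  then show ?thesis by (simp only: weight_act)
qed

lemma nonneg_act:
  assumes "nonneg m n x" "mono \<phi>" "\<phi> l \<le> m" shows "nonneg l n (act l \<phi> x)"
  unfolding nonneg_def
  using nonneg_weight[OF assms(1) map_in_Delta[OF assms(2,3)]] weight_comp_act by simp

lemma frag_of_in_Orient: "f \<in> Delta m n \<Longrightarrow> frag_of f \<in> Orient m n"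
  by (auto simp: Orient_iff frag_of_in_ZDelta coeff_sum_frag_of nonneg_def)

lemma zcomp_in_Orient:
  assumes "x \<in> Orient l m" "y \<in> Orient m n" shows "y \<circ>\<^sub>Z x \<in> Orient l n"
proof -
  have "0 \<le> Poly_Mapping.lookup (y \<circ>\<^sub>Z x \<circ>\<^sub>Z frag_of f) g"
    if f: "f \<in> Delta k l" "distinct f" and g: "g \<in> Delta k n" "distinct g" for k f g
  proof -
    have x: "x \<circ>\<^sub>Z frag_of f \<in> ZDelta k m"
      using assms f by (auto simp: Orient_iff intro: zcomp_in_ZDelta frag_of_in_ZDelta)
    \<comment> \<open>The coefficient of the composite is a sum over the terms \<open>h\<close> of
      the inner composite. Injective \<open>h\<close> give products of two nonnegative numbers,
      degenerate \<open>h\<close> give 0.\<close>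
    have "0 \<le> Poly_Mapping.lookup (x \<circ>\<^sub>Z frag_of f) h * weight (\<lambda>a. simplex_comp a h = g) y"
      if h: "h \<in> Poly_Mapping.keys (x \<circ>\<^sub>Z frag_of f)" for h
    proof (cases "distinct h")
      case True
      have "h \<in> Delta k m" using x h by (auto simp: ZDelta_iff)
      then show ?thesis
        using assms f g True by (auto simp: Orient_iff nonneg_def lookup_zcomp_frag_of)
    next
      case False
      with g show ?thesis by (simp add: weight_comp_not_distinct)
    qed
    then have "0 \<le> Poly_Mapping.lookup (y \<circ>\<^sub>Z (x \<circ>\<^sub>Z frag_of f)) g"
      by (simp only: lookup_eq_weight[of "y \<circ>\<^sub>Z _"] weight_zcomp) (rule sum_nonneg)
    then show ?thesis
      using assms f by (simp add: zcomp_assoc[of y m n x l] Orient_iff)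
  qed
  with assms show ?thesis
    by (auto simp: Orient_iff zcomp_in_ZDelta coeff_sum_zcomp nonneg_def lookup_zcomp_frag_of)
qed

text \<open>At each test pair the two added terms are nonnegative, and the subtracted one vanishes
  or cancels against one of them. The map \<open>\<tau>\<close> sends \<open>i\<close>,
  \<open>i + 1\<close>, \<open>i + 2\<close> to \<open>i + 1\<close> and agrees with
  \<open>dup (Suc i)\<close> away from \<open>i\<close>; this settles the case where
  \<open>f\<close> misses \<open>i\<close>. If \<open>f\<close> contains \<open>i\<close> and
  \<open>\<tau>\<close> stays injective on \<open>f\<close>, then \<open>f\<close> misses
  \<open>i + 2\<close> and the term of \<open>y\<close> cancels it.\<close>

lemma filler_in_Orient:
  assumes x: "x \<in> Orient m n" and y: "y \<in> Orient m n" and i: "i < m"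
    and faces: "face m i x = face m (i + 1) y"
  shows "filler m i x y \<in> Orient (m + 1) n"
proof -
  obtain m' where m: "m = Suc m'" using i by (cases m) auto
  define \<tau> where "\<tau> = (\<lambda>k. skip i (dup i (dup i k)))"
  have mono: "mono \<tau>" by (auto simp: \<tau>_def mono_def skip_def dup_def)
  have fill: "filler m i x y
      = act (Suc m) (dup (Suc i)) x - act (Suc m) \<tau> x + act (Suc m) (dup i) y"
    using i by (simp add: m filler_eq_act \<tau>_def)
  have le: "dup (Suc i) (Suc m) \<le> m" "\<tau> (Suc m) \<le> m" "dup i (Suc m) \<le> m"
    using i by (auto simp: \<tau>_def skip_def dup_def)
  have "0 \<le> weight (\<lambda>a. simplex_comp a f = g) (filler m i x y)"
    if f: "f \<in> Delta l (Suc m)" "distinct f" and g: "g \<in> Delta l n" "distinct g" for l f g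
  proof -
    define W where "W = (\<lambda>z \<phi>. weight (\<lambda>a. simplex_comp a (map \<phi> f) = g) z)"
    have W: "weight (\<lambda>a. simplex_comp a f = g) (filler m i x y)
        = W x (dup (Suc i)) - W x \<tau> + W y (dup i)"
      unfolding W_def fill using f by (simp add: weight_add weight_diff weight_comp_act)
    have nn: "0 \<le> W x (dup (Suc i))" "0 \<le> W y (dup i)"
      unfolding W_def using x y f g le mono_dup
      by (auto simp: Orient_iff intro!: nonneg_weight[of m n _ _ l] map_in_Delta[of _ "Suc m"])
    have f1: "map (dup i) f \<in> Delta l m" using mono_dup le(3) f(1) by (rule map_in_Delta)
    have "dup i m \<le> m'" using i by (simp add: m dup_def)
    with mono_dup have f': "map (dup i) (map (dup i) f) \<in> Delta l m'" using f1 by (rule map_in_Delta)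
    consider "\<not> distinct (map \<tau> f)" | "i \<notin> set f" | "distinct (map \<tau> f)" "i \<in> set f" by blast
    then show ?thesis
    proof cases
      case 1
      then have "W x \<tau> = 0" using g by (simp add: W_def weight_comp_not_distinct)
      then show ?thesis using W nn by simp
    next
      case 2
      then have "map \<tau> f = map (dup (Suc i)) f"
        by (auto simp: \<tau>_def skip_def dup_def intro!: Nat.gr0I)
      then have "W x \<tau> = W x (dup (Suc i))" by (simp only: W_def)
      then show ?thesis using W nn by simp
    next
      case 3
      have "Suc (Suc i) \<notin> set f" 
      proof
        assume "Suc (Suc i) \<in> set f"
        moreover have "\<tau> (Suc (Suc i)) = \<tau> i" by (simp add: \<tau>_def dup_def)
        ultimately show False using 3 by (auto simp: distinct_map dest: inj_onD)
      qed
      \<comment> \<open>Away from \<open>i + 2\<close> the map \<open>dup i\<close> factors through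
        a coface, so the term of \<open>y\<close> depends only on the face that \<open>y\<close>
        shares with \<open>x\<close>.\<close>
      moreover have "skip (Suc i) (dup i (dup i k)) = dup i k" if "k \<noteq> Suc (Suc i)" for k
        using that by (auto simp: skip_def dup_def)
      ultimately have eq: "map (skip (Suc i)) (map (dup i) (map (dup i) f)) = map (dup i) f"
        by (simp add: comp_def) metis
      have "W y (dup i) = weight (\<lambda>a. simplex_comp a (map (dup i) (map (dup i) f)) = g)
          (act m' (skip (Suc i)) y)"
        unfolding W_def weight_comp_act[OF f'] eq ..
      also have "act m' (skip (Suc i)) y = act m' (skip i) x"
        using faces i by (simp add: m face_eq_act)
      also have "weight (\<lambda>a. simplex_comp a (map (dup i) (map (dup i) f)) = g) \<dots> = W x \<tau>"
        unfolding W_def weight_comp_act[OF f'] by (simp add: \<tau>_def comp_def)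
      finally show ?thesis using W nn by simp
    qed
  qed
  moreover have "coeff_sum (filler m i x y) = 1"
    using x y by (simp add: fill coeff_sum_add coeff_sum_diff coeff_sum_act Orient_iff)
  moreover have "filler m i x y \<in> ZDelta (Suc m) n"
    unfolding fill using x y le mono mono_dup
    by (intro ZDelta_add ZDelta_diff act_in_ZDelta[of _ m]) (auto simp: Orient_iff)
  ultimately show ?thesis by (simp add: Orient_iff nonneg_def)
qed

lemma closed_family_Orient: "closed_family Orient"
  unfolding closed_family_def
  using frag_of_in_Orient zcomp_in_Orient filler_in_Orient by (auto simp: Orient_def)

section \<open>The part of an element that hits the last vertex\<close>

definition top_part :: "nat \<Rightarrow> (nat list \<Rightarrow>\<^sub>0 int) \<Rightarrow> (nat list \<Rightarrow>\<^sub>0 int)" where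
  "top_part n x = frag_extend (\<lambda>a. if last a = n then frag_of a else 0) x"

lemma top_part_diff: "top_part n (x - y) = top_part n x - top_part n y"
  by (simp add: top_part_def frag_extend_diff)

lemma top_part_add: "top_part n (x + y) = top_part n x + top_part n y"
  by (simp add: top_part_def frag_extend_add)

lemma weight_top_part: "weight P (top_part n x) = weight (\<lambda>a. P a \<and> last a = n) x"
  unfolding top_part_def using subset_UNIV[of "Poly_Mapping.keys x"]
  by (induction x rule: frag_induction) (auto simp: frag_extend_diff weight_diff)

lemma lookup_top_part:
  "Poly_Mapping.lookup (top_part n x) a = (if last a = n then Poly_Mapping.lookup x a else 0)"
proof (cases "last a = n")
  case True
  then show ?thesis
    unfolding lookup_eq_weight weight_top_part by (auto intro!: weight_cong)
next
  case False
  then have "weight (\<lambda>b. b = a) (top_part n x) = 0"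
    unfolding weight_top_part by (intro weight_eq_0) blast
  with False show ?thesis by (simp add: lookup_eq_weight[of "top_part n x"])
qed

lemma keys_top_part: "Poly_Mapping.keys (top_part n x) = {a \<in> Poly_Mapping.keys x. last a = n}"
  by (auto simp: in_keys_iff lookup_top_part split: if_splits)

lemma top_part_in_ZDelta: "x \<in> ZDelta m n \<Longrightarrow> top_part n' x \<in> ZDelta m n"
  by (auto simp: ZDelta_iff keys_top_part)

lemma diff_top_part_in_ZDelta:
  assumes "x \<in> ZDelta m (Suc n)" shows "x - top_part (Suc n) x \<in> ZDelta m n"
proof -
  have "a \<in> Delta m n" if "a \<in> Poly_Mapping.keys (x - top_part (Suc n) x)" for a
  proof -
    from that have "a \<in> Poly_Mapping.keys x" "last a \<noteq> Suc n"
      by (auto simp: in_keys_iff lookup_minus lookup_top_part split: if_splits)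
    with assms have "a \<in> Delta m (Suc n)" by (auto simp: ZDelta_iff)
    then show ?thesis using Delta_last[of a m "Suc n"] \<open>last a \<noteq> Suc n\<close>
      by (auto simp: Delta_iff_nth)
  qed
  then show ?thesis by (auto simp: ZDelta_iff)
qed

lemma keys_last_le:
  assumes "x \<in> ZDelta m n" "Poly_Mapping.lookup x a \<noteq> 0" shows "last a \<le> n"
proof -
  have "a \<in> Delta m n" using assms by (auto simp: ZDelta_iff in_keys_iff)
  then show ?thesis by (simp add: Delta_last Delta_nth_le)
qed

lemma Delta_mem_le_last: "f \<in> Delta m n \<Longrightarrow> i \<in> set f \<Longrightarrow> i \<le> f ! m"
  by (auto simp: in_set_conv_nth Delta_length less_Suc_eq_le intro: Delta_nth_mono)

text \<open>A monotone tuple bounded by \<open>n\<close> that takes the value \<open>n\<close>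
  anywhere also ends in \<open>n\<close>, so terms outside the top part contribute nothing.\<close>

lemma weight_comp_top_part:
  assumes x: "x \<in> ZDelta m n" and f: "f \<in> Delta l m" and g: "g ! l = n"
  shows "weight (\<lambda>a. simplex_comp a f = g) (top_part n x) = weight (\<lambda>a. simplex_comp a f = g) x"
  unfolding weight_top_part
proof (rule weight_cong)
  fix a assume "a \<in> Poly_Mapping.keys x"
  then have a: "a \<in> Delta m n" using x by (auto simp: ZDelta_iff)
  have fl: "f ! l \<le> m" using f by (simp add: Delta_nth_le)
  have "last a = n" if "simplex_comp a f = g"
  proof -
    have "a ! (f ! l) = n" using that g Delta_length[OF f] by (auto simp: simplex_comp_def)
    then show ?thesis
      using fl Delta_nth_mono[OF a fl] Delta_nth_le[OF a, of m] by (simp add: Delta_last[OF a])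
  qed
  then show "(simplex_comp a f = g \<and> last a = n) = (simplex_comp a f = g)" by blast
qed

text \<open>A face of a simplex with last vertex \<open>n\<close> either has last vertex \<open>n\<close> or can be enlarged
  by it; hence the coefficients of the top part at faces are coefficients of \<open>x\<close> at faces.\<close>

lemma nonneg_top_part:
  assumes x: "x \<in> ZDelta m n" and nn: "nonneg m n x"
  shows "nonneg m n (top_part n x)"
  unfolding nonneg_def
proof (intro allI ballI impI)
  fix l f g
  assume f: "f \<in> Delta l m" "distinct f" and g: "g \<in> Delta l n" "distinct g"
  have len: "length f = Suc l" "length g = Suc l" using f g by (auto simp: Delta_length)
  have keys: "a \<in> Delta m n" if "a \<in> Poly_Mapping.keys x" for a
    using that x by (auto simp: ZDelta_iff)
  have fl: "f ! l \<le> m" using f by (simp add: Delta_nth_le)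
  consider "g ! l = n" | "g ! l < n" "f ! l = m" | "g ! l < n" "f ! l < m"
    using fl g(1) Delta_nth_le[of g l n l] by fastforce
  then show "0 \<le> weight (\<lambda>a. simplex_comp a f = g) (top_part n x)"
  proof cases
    case 1
    then have "weight (\<lambda>a. simplex_comp a f = g) (top_part n x) = weight (\<lambda>a. simplex_comp a f = g) x"
      by (rule weight_comp_top_part[OF x f(1)])
    then show ?thesis using nn f g by (simp add: nonneg_def)
  next
    case 2
    have "weight (\<lambda>a. simplex_comp a f = g) (top_part n x) = 0"
      unfolding weight_top_part
    proof (rule weight_eq_0)
      fix a assume "a \<in> Poly_Mapping.keys x"
      then have "last a = a ! (f ! l)" using 2 keys Delta_last by metis
      then show "\<not> (simplex_comp a f = g \<and> last a = n)"
        using 2 len by (auto simp: simplex_comp_def)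
    qed
    then show ?thesis by simp
  next
    case 3
    have "f @ [m] \<in> Delta (Suc l) m" "g @ [n] \<in> Delta (Suc l) n"
      using f g by (auto simp: Delta_def sorted_append)
    moreover have "m \<notin> set f" "n \<notin> set g"
      using 3 Delta_mem_le_last[OF f(1), of m] Delta_mem_le_last[OF g(1), of n] by auto
    then have "distinct (f @ [m])" "distinct (g @ [n])"
      using f g by auto
    ultimately have "0 \<le> weight (\<lambda>a. simplex_comp a (f @ [m]) = g @ [n]) x"
      using nn by (simp add: nonneg_def)
    \<comment> \<open>The extra vertex \<open>m\<close> of \<open>f\<close> and the extra value
      \<open>n\<close> of \<open>g\<close> together encode the condition
      \<open>last a = n\<close>.\<close>
    also have "\<dots> = weight (\<lambda>a. simplex_comp a f = g) (top_part n x)"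
      unfolding weight_top_part
      by (rule weight_cong) (auto simp: simplex_comp_def Delta_last[OF keys])
    finally show ?thesis .
  qed
qed

text \<open>The cone with apex \<open>v\<close>, the apex being the new last vertex.\<close>

definition app :: "nat \<Rightarrow> (nat list \<Rightarrow>\<^sub>0 int) \<Rightarrow> (nat list \<Rightarrow>\<^sub>0 int)" where
  "app v x = frag_extend (\<lambda>a. frag_of (a @ [v])) x"

lemma app_diff: "app v (x - y) = app v x - app v y"
  by (simp add: app_def frag_extend_diff)

lemma app_add: "app v (x + y) = app v x + app v y"
  by (simp add: app_def frag_extend_add)

lemma app_frag_of [simp]: "app v (frag_of a) = frag_of (a @ [v])"
  by (simp add: app_def)

lemma app_zero [simp]: "app v 0 = 0"
  by (simp add: app_def)

text \<open>The inner \<open>act\<close> forgets the last vertex. On the top part this loses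
  nothing, since the forgotten entry is always \<open>n\<close>.\<close>

lemma top_part_eq_app:
  assumes "x \<in> ZDelta (Suc m) n"
  shows "top_part n x = app n (act m (\<lambda>i. i) (top_part n x))"
  using assms
proof (induction x rule: ZDelta_induct)
  case (one f)
  then have "f = map (\<lambda>i. f ! i) [0..<Suc m] @ [last f]"
    by (intro nth_equalityI) (auto simp: Delta_length nth_append Delta_last less_Suc_eq simp del: upt_Suc)
  then have "last f = n \<longrightarrow> f = map (\<lambda>i. f ! i) [0..<Suc m] @ [n]" by metis
  then show ?case by (simp add: top_part_def act_def app_def frag_of_eq del: upt_Suc)
next
  case (diff a b)
  then show ?case by (simp add: top_part_diff act_diff app_diff)
qed (simp add: top_part_def)

lemma coeff_sum_partition:
  assumes "x \<in> ZDelta m n"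
  shows "coeff_sum x = (\<Sum>v\<le>n. coeff_sum (top_part v x))"
  using assms
proof (induction x rule: ZDelta_induct)
  case (one f)
  have "last f \<le> n" using one by (simp add: Delta_last Delta_nth_le)
  moreover have "coeff_sum (top_part v (frag_of f)) = (if last f = v then 1 else 0)" for v
    by (simp add: top_part_def coeff_sum_frag_of coeff_sum_zero)
  ultimately show ?case by (simp add: coeff_sum_frag_of)
next
  case (diff a b)
  then show ?case by (simp add: top_part_diff coeff_sum_diff sum_subtractf)
qed (simp add: top_part_def coeff_sum_zero)

section \<open>Nonnegative elements with coefficient sum zero\<close>

lemma coeff_sum_top_part_nonneg:
  assumes "x \<in> ZDelta m n" "nonneg m n x" "v \<le> n"
  shows "0 \<le> coeff_sum (top_part v x)"
proof -
  \<comment> \<open>The sum in question is the coefficient of the vertex \<open>v\<close> in the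
    restriction of \<open>x\<close> to its last vertex, so the test in dimension 0 applies.\<close>
  have "0 \<le> weight (\<lambda>a. simplex_comp a [m] = [v]) x"
    by (rule nonneg_weight[OF assms(2), of _ 0]) (use assms(3) in \<open>simp_all add: Delta_def\<close>)
  also have "\<dots> = coeff_sum (top_part v x)"
    unfolding coeff_sum_eq_weight weight_top_part
  proof (rule weight_cong)
    fix a assume "a \<in> Poly_Mapping.keys x"
    with assms(1) have "a \<in> Delta m n" by (auto simp: ZDelta_iff)
    then show "(simplex_comp a [m] = [v]) = (True \<and> last a = v)"
      using Delta_last[of a m n] by (simp add: simplex_comp_def)
  qed
  finally show ?thesis .
qed

lemma nonneg_mono: "nonneg m n' x \<Longrightarrow> n \<le> n' \<Longrightarrow> nonneg m n x"
  using Delta_mono unfolding nonneg_def by blast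

lemma singleton_eq_frag_cmul:
  assumes "Poly_Mapping.keys x \<subseteq> {a}" shows "x = frag_cmul (coeff_sum x) (frag_of a)"
proof (rule poly_mapping_eqI)
  fix b
  have "coeff_sum x = Poly_Mapping.lookup x a"
    unfolding coeff_sum_eq_weight by (subst weight_superset[OF _ assms]) simp_all
  moreover have "Poly_Mapping.lookup x b = 0" if "b \<noteq> a"
    using assms that by (auto simp: in_keys_iff)
  ultimately show "Poly_Mapping.lookup x b = Poly_Mapping.lookup (frag_cmul (coeff_sum x) (frag_of a)) b"
    by (cases "b = a") simp_all
qed

text \<open>The parts of \<open>x\<close> sorted by last entry have nonnegative sums with total 0,
  so the top part has sum 0. It is a cone on an element of lower dimension that vanishes by
  induction on \<open>m\<close>; in dimension 0 it is a multiple of one vertex. Then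
  \<open>x\<close> avoids the last vertex, and an inner induction on \<open>n\<close>
  finishes.\<close>

lemma nonneg_coeff_sum_0_imp_0:
  assumes "x \<in> ZDelta m n" "nonneg m n x" "coeff_sum x = 0"
  shows "x = 0"
  using assms
proof (induction m arbitrary: n x)
  have top: "coeff_sum (top_part n x) = 0"
    if x: "x \<in> ZDelta m n" "nonneg m n x" "coeff_sum x = 0" for m n x
  proof -
    have "(\<Sum>v\<le>n. coeff_sum (top_part v x)) = 0"
      using coeff_sum_partition[OF x(1)] x(3) by simp
    then show ?thesis
      using coeff_sum_top_part_nonneg[OF x(1,2)] by (subst (asm) sum_nonneg_eq_0_iff) auto
  qed
  have eq_0: "x = 0"
    if x: "x \<in> ZDelta m n" "nonneg m n x" "coeff_sum x = 0"
      and *: "\<And>n x. x \<in> ZDelta m n \<Longrightarrow> nonneg m n x \<Longrightarrow> coeff_sum x = 0 \<Longrightarrow> top_part n x = 0"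
    for m n x
    using x
  proof (induction n)
    case 0
    have "top_part 0 x = x"
      using keys_last_le[OF 0(1)] by (intro poly_mapping_eqI) (force simp: lookup_top_part)
    then show ?case using *[OF 0] by simp
  next
    case (Suc n)
    have "x \<in> ZDelta m n"
      using diff_top_part_in_ZDelta[OF Suc.prems(1)] *[OF Suc.prems] by simp
    then show ?case
      using Suc.IH Suc.prems(3) nonneg_mono[OF Suc.prems(2), of n] by simp
  qed
  {
    case 0
    show ?case
    proof (rule eq_0[OF 0])
      fix n x assume x: "x \<in> ZDelta 0 n" "nonneg 0 n x" "coeff_sum x = 0"
      have "Poly_Mapping.keys (top_part n x) \<subseteq> {[n]}"
        using x(1) by (auto simp: keys_top_part ZDelta_iff Delta_def length_Suc_conv)
      then show "top_part n x = 0"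
        using singleton_eq_frag_cmul[of "top_part n x" "[n]"] top[OF x] by simp
    qed
  next
    case (Suc m)
    show ?case
    proof (rule eq_0[OF Suc.prems])
      fix n x assume x: "x \<in> ZDelta (Suc m) n" "nonneg (Suc m) n x" "coeff_sum x = 0"
      have "act m (\<lambda>i. i) (top_part n x) = 0"
        using x top[OF x]
        by (intro Suc.IH[of _ n])
           (auto simp: coeff_sum_act monoI
             intro!: act_in_ZDelta[of _ "Suc m"] nonneg_act[of "Suc m"] top_part_in_ZDelta nonneg_top_part)
      then show "top_part n x = 0"
        by (subst top_part_eq_app[OF x(1)]) simp
    qed
  }
qed

section \<open>The generated family\<close>

text \<open>The smallest closed family. Source and target stay explicit because a formal sum does
  not determine them.\<close>

inductive gen :: "nat \<Rightarrow> nat \<Rightarrow> (nat list \<Rightarrow>\<^sub>0 int) \<Rightarrow> bool" where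
  simplex: "f \<in> Delta m n \<Longrightarrow> gen m n (frag_of f)"
| comp: "gen l m x \<Longrightarrow> gen m n y \<Longrightarrow> gen l n (y \<circ>\<^sub>Z x)"
| fill: "gen m n x \<Longrightarrow> gen m n y \<Longrightarrow> i < m \<Longrightarrow> face m i x = face m (i + 1) y \<Longrightarrow>
    gen (m + 1) n (filler m i x y)"

lemma gen_in_closed_family:
  assumes "closed_family S" "gen m n x" shows "x \<in> S m n"
  using assms(2)
proof induction
  case (simplex f m n)
  then show ?case using assms(1) unfolding closed_family_def by blast
next
  case (comp l m x n y)
  then show ?case using assms(1) unfolding closed_family_def by blast
next
  case (fill m n x y i)
  then show ?case using assms(1) unfolding closed_family_def by blast
qed

lemma gen_in_ZDelta: "gen m n x \<Longrightarrow> x \<in> ZDelta m n"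
  using gen_in_closed_family[OF closed_family_Orient] by (auto simp: Orient_iff)

section \<open>Cones on generated elements\<close>

lemma append_in_Delta: "f \<in> Delta m n \<Longrightarrow> n \<le> v \<Longrightarrow> v \<le> n' \<Longrightarrow> f @ [v] \<in> Delta (Suc m) n'"
  by (fastforce simp: Delta_def sorted_append)

text \<open>Coning is functorial: the entry \<open>Suc m\<close> appended to the inner factor is the
  position of the apex \<open>v\<close> in the outer one.\<close>

lemma app_zcomp:
  assumes "y \<in> ZDelta m n" "x \<in> ZDelta l m"
  shows "app v (y \<circ>\<^sub>Z x) = app v y \<circ>\<^sub>Z app (Suc m) x"
  using assms(2)
proof (induction x rule: ZDelta_induct)
  case (one f)
  show ?case using assms(1)
  proof (induction y rule: ZDelta_induct)
    case (one g)
    have "simplex_comp g f @ [v] = simplex_comp (g @ [v]) (f @ [Suc m])"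
      using Delta_length[OF one] Delta_mem_le[OF \<open>f \<in> Delta l m\<close>]
      by (simp add: simplex_comp_def nth_append less_Suc_eq_le)
    then show ?case by simp
  qed (simp_all add: app_diff zcomp_diff_left)
qed (simp_all add: app_diff zcomp_diff_right)

lemma app_act:
  assumes "x \<in> ZDelta m n" "\<And>i. i \<le> l \<Longrightarrow> \<phi> i \<le> m"
  shows "app v (act l \<phi> x) = act (Suc l) (\<lambda>i. if i \<le> l then \<phi> i else Suc m) (app v x)"
  using assms(1)
proof (induction x rule: ZDelta_induct)
  case (one f)
  have "map (\<lambda>i. f ! \<phi> i) [0..<Suc l] @ [v]
      = map (\<lambda>i. (f @ [v]) ! (if i \<le> l then \<phi> i else Suc m)) [0..<Suc (Suc l)]"
    using Delta_length[OF one] assms(2)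
    by (intro nth_equalityI) (auto simp: nth_append less_Suc_eq_le simp del: upt_Suc)
  then show ?case by (simp add: act_def app_def del: upt_Suc)
qed (simp_all add: app_diff act_diff)

lemma app_face:
  assumes "x \<in> ZDelta (Suc m) n" "i \<le> Suc m"
  shows "face (Suc (Suc m)) i (app v x) = app v (face (Suc m) i x)"
proof -
  have "app v (act m (skip i) x) = act (Suc m) (\<lambda>k. if k \<le> m then skip i k else Suc (Suc m)) (app v x)"
    using assms by (intro app_act) (auto simp: skip_def)
  also have "\<dots> = act (Suc m) (skip i) (app v x)"
    using assms by (intro act_cong) (auto simp: skip_def)
  finally show ?thesis using assms by (simp add: face_eq_act)
qed

text \<open>All three vertex maps in a filler send the last vertex to the last vertex, so they
  extend over the apex.\<close>

lemma app_filler: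
  assumes "x \<in> ZDelta (Suc m) n" "y \<in> ZDelta (Suc m) n" "i < Suc m"
  shows "filler (Suc (Suc m)) i (app v x) (app v y) = app v (filler (Suc m) i x y)"
proof -
  have *: "app v (act (Suc (Suc m)) \<phi> z) = act (Suc (Suc (Suc m))) \<phi> (app v z)"
    if "z \<in> ZDelta (Suc m) n" "\<And>k. k \<le> Suc (Suc m) \<Longrightarrow> \<phi> k \<le> Suc m"
      "\<phi> (Suc (Suc (Suc m))) = Suc (Suc m)" for z \<phi>
  proof -
    have "app v (act (Suc (Suc m)) \<phi> z)
        = act (Suc (Suc (Suc m))) (\<lambda>k. if k \<le> Suc (Suc m) then \<phi> k else Suc (Suc m)) (app v z)"
      using that by (intro app_act)
    also have "\<dots> = act (Suc (Suc (Suc m))) \<phi> (app v z)"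
      using that(3) by (intro act_cong) (auto simp: not_le dest: le_antisym)
    finally show ?thesis .
  qed
  have "app v (act (Suc (Suc m)) (dup (Suc i)) x) = act (Suc (Suc (Suc m))) (dup (Suc i)) (app v x)"
    using assms by (intro *) (auto simp: dup_def)
  moreover have "app v (act (Suc (Suc m)) (dup i) y) = act (Suc (Suc (Suc m))) (dup i) (app v y)"
    using assms by (intro *) (auto simp: dup_def)
  moreover have "app v (act (Suc (Suc m)) (\<lambda>k. skip i (dup i (dup i k))) x)
      = act (Suc (Suc (Suc m))) (\<lambda>k. skip i (dup i (dup i k))) (app v x)"
    using assms by (intro *) (auto simp: dup_def skip_def)
  ultimately show ?thesis using assms(3) by (simp add: filler_eq_act app_add app_diff)
qed

text \<open>The apex is a fresh vertex so that the induction passes through composition, where the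
  inner factor must be coned with apex \<open>Suc m\<close>.\<close>

lemma gen_app_Suc: "gen m n x \<Longrightarrow> gen (Suc m) (Suc n) (app (Suc n) x)"
proof (induction rule: gen.induct)
  case (simplex f m n)
  then show ?case by (simp add: append_in_Delta gen.simplex)
next
  case (comp l m x n y)
  then show ?case
    using app_zcomp[of y m n x l] by (auto simp: gen_in_ZDelta intro: gen.comp)
next
  case (fill m n x y i)
  obtain m' where m: "m = Suc m'" using \<open>i < m\<close> by (cases m) auto
  have ZD: "x \<in> ZDelta (Suc m') n" "y \<in> ZDelta (Suc m') n"
    using fill.hyps by (auto simp: m dest: gen_in_ZDelta)
  have "gen (Suc m + 1) (Suc n) (filler (Suc m) i (app (Suc n) x) (app (Suc n) y))"
    using fill ZD by (intro gen.fill) (auto simp: m app_face)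
  then show ?case using fill.hyps ZD by (simp add: m app_filler)
qed

lemma gen_app:
  assumes "gen m n x" shows "gen (Suc m) n (app n x)"
proof -
  \<comment> \<open>The fresh apex \<open>Suc n\<close> is identified with \<open>n\<close> by a
    degeneracy.\<close>
  have "frag_of ([0..<Suc n] @ [n]) \<circ>\<^sub>Z app (Suc n) x = app n x"
    using gen_in_ZDelta[OF assms]
  proof (induction x rule: ZDelta_induct)
    case (one f)
    have "simplex_comp ([0..<Suc n] @ [n]) (f @ [Suc n]) = f @ [n]"
      using Delta_mem_le[OF one]
      by (auto simp: simplex_comp_def nth_append less_Suc_eq_le map_idI simp del: upt_Suc)
    then show ?case by (simp del: upt_Suc)
  qed (simp_all add: app_diff zcomp_diff_right del: upt_Suc)
  moreover have "gen (Suc n) n (frag_of ([0..<Suc n] @ [n]))"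
    by (intro gen.simplex append_in_Delta[of _ _ n]) (auto simp: Delta_def simp del: upt_Suc)
  ultimately show ?thesis using gen.comp[OF gen_app_Suc[OF assms]] by metis
qed

section \<open>Change of target, reindexing and sums of generated elements\<close>

lemma gen_mono:
  assumes "gen m n x" "n \<le> n'" shows "gen m n' x"
proof -
  have "frag_of [0..<Suc n] \<circ>\<^sub>Z x = x"
    using gen_in_ZDelta[OF assms(1)]
  proof (induction x rule: ZDelta_induct)
    case (one f)
    have "simplex_comp [0..<Suc n] f = f"
      using Delta_mem_le[OF one]
      by (auto simp: simplex_comp_def less_Suc_eq_le map_idI simp del: upt_Suc)
    then show ?case by (simp del: upt_Suc)
  qed (simp_all add: zcomp_diff_right del: upt_Suc)
  moreover have "gen n n' (frag_of [0..<Suc n])"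
    using assms(2) by (intro gen.simplex) (auto simp: Delta_def simp del: upt_Suc)
  ultimately show ?thesis using gen.comp[OF assms(1)] by metis
qed

lemma gen_act:
  assumes "gen m n x" "mono \<phi>" "\<phi> l \<le> m" shows "gen l n (act l \<phi> x)"
  unfolding act_eq_zcomp
  using gen.comp[OF gen.simplex[OF map_upt_in_Delta[OF assms(2,3)]] assms(1)] .

text \<open>The elements in \<open>a\<close> and \<open>b\<close> have matching faces. In their
  filler the cross terms, in which \<open>j\<close>, \<open>j + 1\<close>, \<open>j + 2\<close> are
  collapsed to one vertex, cancel and leave the first conclusion. Its middle face, omitting
  \<open>j + 1\<close>, undoes both degeneracies and gives \<open>p + q\<close>.\<close>

lemma
  assumes p: "p \<in> ZDelta (Suc m) n" and q: "q \<in> ZDelta (Suc m) n" and j: "j \<le> m"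
    and a: "gen (Suc m) n (q + act (Suc m) (\<lambda>k. if k = Suc j then j else k) p)"
    and b: "gen (Suc m) n (p + act (Suc m) (\<lambda>k. if k = j then Suc j else k) q)"
  shows gen_dup_add_dup:
      "gen (Suc (Suc m)) n (act (Suc (Suc m)) (dup j) p + act (Suc (Suc m)) (dup (Suc j)) q)"
    and gen_add: "gen (Suc m) n (p + q)"
proof -
  let ?a = "q + act (Suc m) (\<lambda>k. if k = Suc j then j else k) p"
  let ?b = "p + act (Suc m) (\<lambda>k. if k = j then Suc j else k) q"
  let ?M = "Suc (Suc m)"
  have "act m (skip j) ?a = act m (skip j) q + act m (skip (Suc j)) p"
    using j by (auto simp: act_add act_act skip_def intro!: act_cong)
  moreover have "act m (skip (Suc j)) ?b = act m (skip (Suc j)) p + act m (skip j) q"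
    using j by (auto simp: act_add act_act skip_def intro!: act_cong)
  ultimately have faces: "face (Suc m) j ?a = face (Suc m) (j + 1) ?b"
    using j by (simp add: face_eq_act)
  have le: "dup (Suc j) k \<le> Suc m" "dup j k \<le> Suc m" "skip j (dup j (dup j k)) \<le> Suc m"
    if "k \<le> ?M" for k
    using j that by (auto simp: skip_def dup_def)
  have "act ?M (dup (Suc j)) ?a
      = act ?M (dup (Suc j)) q + act ?M (\<lambda>k. skip (Suc j) (dup j (dup j k))) p"
    using j le by (simp add: act_add act_act) (auto simp: skip_def dup_def intro!: act_cong)
  moreover have "act ?M (\<lambda>k. skip j (dup j (dup j k))) ?a
      = act ?M (\<lambda>k. skip j (dup j (dup j k))) q + act ?M (\<lambda>k. skip (Suc j) (dup j (dup j k))) p"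
    using j le by (simp add: act_add act_act) (auto simp: skip_def dup_def intro!: act_cong)
  moreover have "act ?M (dup j) ?b = act ?M (dup j) p + act ?M (\<lambda>k. skip j (dup j (dup j k))) q"
    using j le by (simp add: act_add act_act) (auto simp: skip_def dup_def intro!: act_cong)
  ultimately have "filler (Suc m) j ?a ?b = act ?M (dup j) p + act ?M (dup (Suc j)) q"
    using j by (simp add: filler_eq_act)
  then show sum: "gen ?M n (act ?M (dup j) p + act ?M (dup (Suc j)) q)"
    using gen.fill[OF a b _ faces] j by simp
  have "act (Suc m) (skip (Suc j)) (act ?M \<phi> z) = z"
    if "\<phi> = dup j \<or> \<phi> = dup (Suc j)" "z \<in> ZDelta (Suc m) n" for \<phi> z
  proof -
    have "act (Suc m) (skip (Suc j)) (act ?M \<phi> z) = act (Suc m) (\<lambda>k. \<phi> (skip (Suc j) k)) z"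
      by (rule act_act) (auto simp: skip_def)
    also have "\<dots> = act (Suc m) (\<lambda>k. k) z"
      using that(1) by (intro act_cong) (auto simp: skip_def dup_def)
    finally show ?thesis using that(2) by (simp add: act_id)
  qed
  moreover have "skip (Suc j) (Suc m) \<le> ?M" by (simp add: skip_def)
  ultimately show "gen (Suc m) n (p + q)"
    using gen_act[OF sum mono_skip, of "Suc j" "Suc m"] p q by (simp add: act_add)
qed

section \<open>Every element of the orientals is generated\<close>

text \<open>If \<open>g\<close> ends in \<open>n\<close>, then \<open>x\<close> and its top part
  have the same coefficient. Otherwise the top part contributes 0: its terms equal \<open>n\<close>
  from position \<open>t\<close> on, and \<open>f\<close> reaches that range.\<close>

lemma nonneg_diff_top_part:
  assumes x: "x \<in> ZDelta m n" "nonneg m n x" and t: "t \<le> m"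
    and c: "\<And>a. a \<in> Poly_Mapping.keys (top_part n x) \<Longrightarrow> a ! t = n"
    and f: "f \<in> Delta k m" "t \<le> f ! k" and g: "g \<in> Delta k n" "distinct g"
  shows "0 \<le> weight (\<lambda>a. simplex_comp a f = g) (x - top_part n x)"
proof (cases "g ! k = n")
  case True
  then show ?thesis by (simp add: weight_diff weight_comp_top_part[OF x(1) f(1)])
next
  case False
  have "weight (\<lambda>a. simplex_comp a f = g) (top_part n x) = 0"
  proof (rule weight_eq_0)
    fix a assume a: "a \<in> Poly_Mapping.keys (top_part n x)"
    then have "a \<in> Delta m n" using x(1) by (auto simp: keys_top_part ZDelta_iff)
    moreover have "f ! k \<le> m" using f(1) by (simp add: Delta_nth_le)
    ultimately have "a ! (f ! k) = n"
      using Delta_nth_mono[of a m n t "f ! k"] Delta_nth_le[of a m n "f ! k"] c[OF a] f(2) by simp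
    then show "simplex_comp a f \<noteq> g"
      using False Delta_length[OF f(1)] by (auto simp: simplex_comp_def)
  qed
  moreover have "0 \<le> weight (\<lambda>a. simplex_comp a f = g) x"
    using x(2) f(1) g by (rule nonneg_weight)
  ultimately show ?thesis by (simp add: weight_diff)
qed

text \<open>The two parts of \<open>x\<close> may be reindexed differently wherever \<open>s\<close>
  hits \<open>t\<close>. If \<open>f\<close> meets such a vertex, both summands are nonnegative
  separately. If not, \<open>\<sigma>\<close> and \<open>s\<close> agree on \<open>f\<close>, and
  the sum is a coefficient of \<open>x\<close>.\<close>

lemma act_top_part_add_act_in_Orient:
  assumes x: "x \<in> Orient m n" and sum: "coeff_sum (top_part n x) = 1" and t: "t \<le> m"
    and c: "\<And>a. a \<in> Poly_Mapping.keys (top_part n x) \<Longrightarrow> a ! t = n"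
    and mono: "mono \<sigma>" "mono s" and le: "\<sigma> l \<le> m" "s l \<le> m"
    and eq: "\<And>i. i \<le> l \<Longrightarrow> \<sigma> i = s i \<or> s i = t"
  shows "act l \<sigma> (top_part n x) + act l s (x - top_part n x) \<in> Orient l n"
proof -
  have ZD: "x \<in> ZDelta m n" "top_part n x \<in> ZDelta m n" "x - top_part n x \<in> ZDelta m n"
    using x by (auto simp: Orient_iff intro: top_part_in_ZDelta ZDelta_diff)
  have nn: "nonneg m n x" using x by (simp add: Orient_iff)
  have "0 \<le> weight (\<lambda>a. simplex_comp a f = g)
      (act l \<sigma> (top_part n x) + act l s (x - top_part n x))"
    if f: "f \<in> Delta k l" and g: "g \<in> Delta k n" "distinct g" for k f g
  proof -
    have f': "map \<sigma> f \<in> Delta k m" "map s f \<in> Delta k m"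
      using map_in_Delta mono le f by auto
    have eq_W: "weight (\<lambda>a. simplex_comp a f = g)
        (act l \<sigma> (top_part n x) + act l s (x - top_part n x))
        = weight (\<lambda>a. simplex_comp a (map \<sigma> f) = g) (top_part n x)
          + weight (\<lambda>a. simplex_comp a (map s f) = g) (x - top_part n x)"
      using f by (simp add: weight_add weight_comp_act)
    show ?thesis
    proof (cases "\<exists>i\<in>set f. s i = t")
      case True
      then obtain i where i: "i \<in> set f" "s i = t" by blast
      then have "t \<le> s (f ! k)" using Delta_mem_le_last[OF f] mono(2) by (auto dest: monoD)
      then have "t \<le> map s f ! k" using Delta_length[OF f] by simp
      then have "0 \<le> weight (\<lambda>a. simplex_comp a (map s f) = g) (x - top_part n x)"
        using nonneg_diff_top_part[OF ZD(1) nn t c f'(2) _ g] by blast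
      moreover have "0 \<le> weight (\<lambda>a. simplex_comp a (map \<sigma> f) = g) (top_part n x)"
        using nonneg_top_part[OF ZD(1) nn] f'(1) g by (rule nonneg_weight)
      ultimately show ?thesis using eq_W by simp
    next
      case False
      then have "map \<sigma> f = map s f" using eq Delta_mem_le[OF f] by auto
      then show ?thesis
        using eq_W nonneg_weight[OF nn f'(2) g] by (simp add: weight_diff del: map_eq_conv)
    qed
  qed
  then show ?thesis
    using x ZD sum mono le
    by (auto simp: Orient_iff nonneg_def coeff_sum_add coeff_sum_diff coeff_sum_act
        intro!: ZDelta_add act_in_ZDelta[of _ m])
qed

text \<open>Put \<open>c = top_part n x\<close> and \<open>d = x - c\<close>. The elements \<open>c + d \<circ> s\<^sub>j\<close> with
  \<open>s\<^sub>j = (0,\<dots>,j-1,t,\<dots>,t,t+1,\<dots>,m)\<close> interpolate between \<open>c\<close> (for \<open>j = 0\<close>, because the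
  nonnegative element \<open>d \<circ> (t,\<dots>,m)\<close> has coefficient sum \<open>0\<close>) and \<open>x\<close> (for \<open>j = t\<close>). Each is
  the middle face of a filler of its predecessor and an element that is again a filler, of
  elements of dimension \<open>m - 1\<close>, except at the last step, where it is the element \<open>w\<close> below.\<close>

lemma gen_if_gen_shift:
  assumes x: "x \<in> Orient m n" and sum: "coeff_sum (top_part n x) = 1" and t: "t \<le> m"
    and c: "\<And>a. a \<in> Poly_Mapping.keys (top_part n x) \<Longrightarrow> a ! t = n"
    and gen_c: "gen m n (top_part n x)"
    and IH: "\<And>m' y. m = Suc m' \<Longrightarrow> y \<in> Orient m' n \<Longrightarrow> gen m' n y"
    and w: "0 < t \<Longrightarrow> gen m n (act m (\<lambda>k. if k = t then t - 1 else k) (top_part n x)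
      + (x - top_part n x))"
  shows "gen m n x"
proof -
  define d where "d = x - top_part n x"
  define s where "s = (\<lambda>j i. if i < j then i else max t i)"
  let ?c = "top_part n x"
  have ZD: "x \<in> ZDelta m n" "?c \<in> ZDelta m n" "d \<in> ZDelta m n"
    using x unfolding d_def by (auto simp: Orient_iff intro: top_part_in_ZDelta ZDelta_diff)
  have nn: "nonneg m n x" using x by (simp add: Orient_iff)
  have s_t: "act m (s t) d = d"
  proof -
    have "act m (s t) d = act m (\<lambda>i. i) d" by (rule act_cong) (simp add: s_def)
    then show ?thesis using ZD by (simp add: act_id)
  qed
  have "gen m n (?c + act m (s j) d)" if "j \<le> t" for j
    using that
  proof (induction j)
    case 0
    have "act (m - t) (\<lambda>i. t + i) d = 0"
    proof (rule nonneg_coeff_sum_0_imp_0)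
      show "act (m - t) (\<lambda>i. t + i) d \<in> ZDelta (m - t) n"
        using ZD t by (intro act_in_ZDelta) (auto simp: mono_def)
      show "coeff_sum (act (m - t) (\<lambda>i. t + i) d) = 0"
        using x sum by (simp add: coeff_sum_act d_def coeff_sum_diff Orient_iff)
      show "nonneg (m - t) n (act (m - t) (\<lambda>i. t + i) d)"
        unfolding nonneg_def
      proof (intro allI ballI impI)
        fix l f g
        assume f: "f \<in> Delta l (m - t)" and g: "g \<in> Delta l n" "distinct g"
        have "map (\<lambda>i. t + i) f \<in> Delta l m"
          using f t by (intro map_in_Delta[of _ "m - t"]) (auto simp: mono_def)
        moreover have "t \<le> map (\<lambda>i. t + i) f ! l" using Delta_length[OF f] by simp
        ultimately show "0 \<le> weight (\<lambda>a. simplex_comp a f = g) (act (m - t) (\<lambda>i. t + i) d)"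
          unfolding weight_comp_act[OF f] d_def
          using nonneg_diff_top_part[OF ZD(1) nn t c] g by blast
      qed
    qed
    \<comment> \<open>All values of \<open>s 0\<close> are at least \<open>t\<close>, so this
      element factors through the one just shown to vanish.\<close>
    moreover have "act m (s 0) d = act m (\<lambda>i. max t i - t) (act (m - t) (\<lambda>i. t + i) d)"
      using t by (subst act_act) (auto simp: s_def intro!: act_cong)
    ultimately show ?case using gen_c by simp
  next
    case (Suc j)
    obtain m' where m: "m = Suc m'" using Suc.prems t by (cases m) auto
    have j: "j \<le> m'" using Suc.prems t m by simp
    have mono_s: "mono (\<lambda>i. s (Suc j) (\<phi> i))" if "mono \<phi>" for \<phi> :: "nat \<Rightarrow> nat"
    proof (rule monoI)
      fix i i' :: nat assume "i \<le> i'"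
      with that have "\<phi> i \<le> \<phi> i'" by (rule monoD)
      then show "s (Suc j) (\<phi> i) \<le> s (Suc j) (\<phi> i')" using Suc.prems by (auto simp: s_def)
    qed
    \<comment> \<open>Since \<open>j < t\<close>, moving \<open>j\<close> to \<open>j + 1\<close>
      before \<open>s (Suc j)\<close> gives \<open>s j\<close>; hence \<open>b\<close> is the
      induction hypothesis.\<close>
    have "act (Suc m') (\<lambda>k. if k = j then Suc j else k) (act (Suc m') (s (Suc j)) d)
        = act (Suc m') (\<lambda>k. s (Suc j) (if k = j then Suc j else k)) d"
      using j by (intro act_act) auto
    also have "\<dots> = act (Suc m') (s j) d"
      using Suc.prems by (intro act_cong) (auto simp: s_def)
    finally have b: "gen (Suc m') n
        (?c + act (Suc m') (\<lambda>k. if k = j then Suc j else k) (act (Suc m') (s (Suc j)) d))"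
      using Suc m by simp
    have "gen (Suc m') n (act (Suc m') (s (Suc j)) d
        + act (Suc m') (\<lambda>k. if k = Suc j then j else k) ?c)"
    proof (cases "Suc j = t")
      case True
      then have "(\<lambda>k. if k = t then t - 1 else k) = (\<lambda>k. if k = Suc j then j else k)" by auto
      then show ?thesis using w s_t True by (simp add: m d_def add.commute)
    next
      case False
      with Suc.prems t m obtain m'' where m': "m' = Suc m''" by (cases m') auto
      have j': "j \<le> m''" "Suc (Suc j) \<le> t" using False Suc.prems t m m' by auto
      \<comment> \<open>As \<open>j + 2 \<le> t\<close>, the map \<open>s (Suc j)\<close> takes the
        value \<open>t\<close> at both \<open>j + 1\<close> and \<open>j + 2\<close>. So both
        summands are degenerate, on \<open>p\<close> and \<open>q\<close> of dimension
        \<open>m - 1\<close>, and \<open>gen_dup_add_dup\<close> applies to these.\<close>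
      define p where "p = act m' (skip (Suc j)) ?c"
      define q where "q = act m' (\<lambda>i. s (Suc j) (skip (Suc j) i)) d"
      have le: "s (Suc j) i \<le> m" if "i \<le> m" for i using that t by (auto simp: s_def)
      have pq: "p \<in> ZDelta (Suc m'') n" "q \<in> ZDelta (Suc m'') n"
        unfolding p_def q_def m'[symmetric]
        using act_in_ZDelta[OF ZD(2) mono_skip, of "Suc j" m']
          act_in_ZDelta[OF ZD(3) mono_s[OF mono_skip], of "Suc j" m'] le[of "skip (Suc j) m'"]
        by (simp_all add: m skip_def)
      have 1: "gen m' n (q + act m' (\<lambda>k. if k = Suc j then j else k) p)"
      proof -
        have "act m' (\<lambda>k. if k = Suc j then j else k) p
            = act m' (\<lambda>k. skip (Suc j) (if k = Suc j then j else k)) ?c"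
          unfolding p_def using j' by (intro act_act) (auto simp: m')
        moreover have "act m' (\<lambda>k. skip (Suc j) (if k = Suc j then j else k)) ?c + q \<in> Orient m' n"
          unfolding q_def d_def
        proof (rule act_top_part_add_act_in_Orient[OF x sum t c _ mono_s[OF mono_skip]])
          show "mono (\<lambda>k. skip (Suc j) (if k = Suc j then j else k))"
            by (auto simp: mono_def skip_def)
          show "s (Suc j) (skip (Suc j) m') \<le> m"
            by (rule le) (simp add: m skip_def)
          show "skip (Suc j) (if m' = Suc j then j else m') \<le> m"
            by (simp add: m skip_def)
          show "skip (Suc j) (if i = Suc j then j else i) = s (Suc j) (skip (Suc j) i)
              \<or> s (Suc j) (skip (Suc j) i) = t" for i
            using j'(2) by (auto simp: s_def skip_def max_def)
        qed
        ultimately show ?thesis using IH[OF m] by (simp add: add.commute)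
      qed
      have 2: "gen m' n (p + act m' (\<lambda>k. if k = j then Suc j else k) q)"
      proof -
        have "act m' (\<lambda>k. if k = j then Suc j else k) q
            = act m' (\<lambda>k. s (Suc j) (skip (Suc j) (if k = j then Suc j else k))) d"
          unfolding q_def using j' by (intro act_act) (auto simp: m')
        moreover have mono: "mono (\<lambda>k. skip (Suc j) (if k = j then Suc j else k))"
          by (auto simp: mono_def skip_def)
        have "p + act m' (\<lambda>k. s (Suc j) (skip (Suc j) (if k = j then Suc j else k))) d
            \<in> Orient m' n"
          unfolding p_def d_def
        proof (rule act_top_part_add_act_in_Orient[OF x sum t c mono_skip mono_s[OF mono]])
          show "skip (Suc j) m' \<le> m"
            by (simp add: m skip_def)
          show "s (Suc j) (skip (Suc j) (if m' = j then Suc j else m')) \<le> m"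
            by (rule le) (use j' in \<open>simp add: m m' skip_def\<close>)
          show "skip (Suc j) i = s (Suc j) (skip (Suc j) (if i = j then Suc j else i))
              \<or> s (Suc j) (skip (Suc j) (if i = j then Suc j else i)) = t" for i
            using j'(2) by (auto simp: s_def skip_def max_def)
        qed
        ultimately show ?thesis using IH[OF m] by simp
      qed
      have "act (Suc m') (dup j) p = act (Suc m') (\<lambda>k. if k = Suc j then j else k) ?c"
        unfolding p_def using j'
        by (subst act_act) (auto simp: m' dup_def skip_def intro!: act_cong)
      moreover have "act (Suc m') (dup (Suc j)) q = act (Suc m') (s (Suc j)) d"
        unfolding q_def using j'
        by (subst act_act) (auto simp: m' dup_def skip_def s_def intro!: act_cong)
      ultimately show ?thesis
        using gen_dup_add_dup[OF pq j'(1)] 1 2 by (simp add: m' add.commute)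
    qed
    note a = this
    have "gen (Suc m') n (?c + act (Suc m') (s (Suc j)) d)"
    proof (rule gen_add[OF _ _ j a b])
      show "?c \<in> ZDelta (Suc m') n" using ZD(2) by (simp add: m)
      have "mono (s (Suc j))" using mono_s[of "\<lambda>i. i"] by (simp add: mono_def)
      moreover have "s (Suc j) (Suc m') \<le> m" using t m by (simp add: s_def)
      ultimately show "act (Suc m') (s (Suc j)) d \<in> ZDelta (Suc m') n"
        using ZD(3) by (intro act_in_ZDelta)
    qed
    then show ?case by (simp add: m)
  qed
  from this[of t] show ?thesis by (simp add: s_t) (simp add: d_def)
qed

text \<open>No entry of a monotone tuple exceeds its last one, so reindexing cannot create a term
  that ends in \<open>n\<close>.\<close>

lemma top_part_act_eq_0:
  assumes z: "z \<in> ZDelta m n" "top_part n z = 0" and \<phi>: "\<phi> l \<le> m"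
  shows "top_part n (act l \<phi> z) = 0"
proof -
  have "last a \<noteq> n" if a: "a \<in> Poly_Mapping.keys (act l \<phi> z)" for a
  proof -
    obtain b where b: "b \<in> Poly_Mapping.keys z" "a = map (\<lambda>i. b ! \<phi> i) [0..<Suc l]"
      using a keys_act[of l \<phi> z] by blast
    have bD: "b \<in> Delta m n" using z b by (auto simp: ZDelta_iff)
    have "last b \<noteq> n"
      using b(1) arg_cong[OF z(2), of "\<lambda>z. Poly_Mapping.lookup z b"]
      by (auto simp: lookup_top_part in_keys_iff)
    then have "b ! m < n" using bD Delta_nth_le[OF bD, of m] by (simp add: Delta_last[OF bD])
    then have "b ! \<phi> l < n" using Delta_nth_mono[OF bD \<phi>] by simp
    then show ?thesis by (simp add: b)
  qed
  then show ?thesis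
    by (intro poly_mapping_eqI) (auto simp: lookup_top_part in_keys_iff)
qed

text \<open>Passing from \<open>x\<close> to \<open>w\<close> replaces the tuples of the top part by degenerate ones. This is
  recorded by a map \<open>u\<close> through which the top part factors: the number of distinct values of
  \<open>u\<close> need not drop, but the sum of its values does.\<close>

lemma gen_if_top_part_factors:
  assumes IHm: "\<And>m' y. m = Suc m' \<Longrightarrow> y \<in> Orient m' n \<Longrightarrow> gen m' n y"
    and IHn: "\<And>n' y. n = Suc n' \<Longrightarrow> y \<in> Orient m n' \<Longrightarrow> gen m n' y"
    and B: "B \<in> ZDelta m n"
  shows "x \<in> Orient m n \<Longrightarrow> mono u \<Longrightarrow> u m \<le> m \<Longrightarrow> top_part n (x - act m u B) = 0 \<Longrightarrow> gen m n x"
proof (induction "\<Sum>i\<le>m. u i" arbitrary: u x rule: less_induct)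
  case less
  have x: "x \<in> ZDelta m n" "nonneg m n x" "coeff_sum x = 1"
    using less.prems by (auto simp: Orient_iff)
  let ?c = "top_part n x"
  define d where "d = x - ?c"
  have ZD: "?c \<in> ZDelta m n" "d \<in> ZDelta m n" "act m u B \<in> ZDelta m n"
    using x(1) B less.prems unfolding d_def
    by (auto intro: top_part_in_ZDelta ZDelta_diff act_in_ZDelta)
  have sum: "(\<Sum>v\<le>n. coeff_sum (top_part v x)) = 1"
    using coeff_sum_partition[OF x(1)] x(3) by simp
  have "coeff_sum ?c \<le> (\<Sum>v\<le>n. coeff_sum (top_part v x))"
    using coeff_sum_top_part_nonneg[OF x(1,2)] by (intro member_le_sum) auto
  then consider "coeff_sum ?c = 0" | "coeff_sum ?c = 1"
    using sum coeff_sum_top_part_nonneg[OF x(1,2), of n] by fastforce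
  then show ?case
  proof cases
    case 1
    then have "?c = 0" using ZD(1) nonneg_top_part[OF x(1,2)] by (intro nonneg_coeff_sum_0_imp_0)
    obtain n' where n: "n = Suc n'" using 1 sum by (cases n) auto
    have "x \<in> Orient m n'"
      using diff_top_part_in_ZDelta[of x m n'] \<open>?c = 0\<close> x nonneg_mono[OF x(2), of n']
      by (simp add: Orient_iff n)
    then show ?thesis using IHn[OF n] gen_mono[of m n' x n] n by simp
  next
    case 2
    \<comment> \<open>The top part factors through \<open>u\<close>, so its terms are constant from
      the first position where \<open>u\<close> attains its final value.\<close>
    define t where "t = (LEAST i. u i = u m)"
    have ut: "u t = u m" unfolding t_def by (rule LeastI) simp
    have tm: "t \<le> m" unfolding t_def by (rule Least_le) simp
    have c_eq: "?c = top_part n (act m u B)" using less.prems(4) by (simp add: top_part_diff)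
    have c: "a ! t = n" if "a \<in> Poly_Mapping.keys ?c" for a
    proof -
      have a: "a \<in> Poly_Mapping.keys (act m u B)" "last a = n"
        using that by (auto simp: c_eq keys_top_part)
      then obtain b where "a = map (\<lambda>i. b ! u i) [0..<Suc m]"
        using keys_act[of m u B] by blast
      then show ?thesis using a(2) ut tm by (simp add: nth_append)
    qed
    have gen_c: "gen m n ?c"
    proof (cases m)
      case 0
      have "Poly_Mapping.keys ?c \<subseteq> {[n]}"
        using x(1) by (auto simp: 0 keys_top_part ZDelta_iff Delta_def length_Suc_conv)
      then have "?c = frag_of [n]" using singleton_eq_frag_cmul[of ?c "[n]"] 2 by simp
      then show ?thesis by (simp add: 0 gen.simplex Delta_def)
    next
      case (Suc m')
      have "act m' (\<lambda>i. i) ?c \<in> Orient m' n"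
        using ZD(1) 2 nonneg_top_part[OF x(1,2)]
        by (auto simp: Orient_iff coeff_sum_act Suc monoI
            intro!: act_in_ZDelta[of _ "Suc m'"] nonneg_act[of "Suc m'"])
      then have "gen m n (app n (act m' (\<lambda>i. i) ?c))" using gen_app[OF IHm[OF Suc]] Suc by simp
      then show ?thesis using top_part_eq_app[of x m' n] x(1) Suc by simp
    qed
    show ?thesis
    proof (rule gen_if_gen_shift[OF less.prems(1) 2 tm c gen_c IHm])
      assume t0: "0 < t"
      define e where "e = (\<lambda>k. if k = t then t - 1 else k)"
      have mono_e: "mono e" by (auto simp: e_def mono_def)
      have em: "e k \<le> m" if "k \<le> m" for k using that by (auto simp: e_def)
      have "act m e ?c + act m (\<lambda>i. i) (x - ?c) \<in> Orient m n"
        using mono_e em c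
        by (intro act_top_part_add_act_in_Orient[OF less.prems(1) 2 tm]) (auto simp: e_def mono_def)
      then have w: "act m e ?c + d \<in> Orient m n" using ZD(2) by (simp add: d_def act_id)
      have "u (t - 1) \<noteq> u m" unfolding t_def using t0 by (intro not_less_Least) (simp add: t_def)
      moreover have "u (t - 1) \<le> u t" using less.prems(2) by (rule monoD) simp
      ultimately have lt: "u (t - 1) < u t" using ut by simp
      \<comment> \<open>By minimality of \<open>t\<close>, \<open>u\<close> jumps between
        \<open>t - 1\<close> and \<open>t\<close>, so collapsing \<open>t\<close> to
        \<open>t - 1\<close> lowers the sum.\<close>
      have small: "(\<Sum>i\<le>m. u (e i)) < (\<Sum>i\<le>m. u i)"
        using lt tm by (intro sum_strict_mono_ex1) (auto simp: e_def)
      have act_u: "act m (\<lambda>i. u (e i)) B = act m e (act m u B)"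
        using em by (simp add: act_act)
      \<comment> \<open>None of the three summands on the right of \<open>eq\<close> has a top part,
        so the top part of the new element factors through \<open>u\<close> composed with
        \<open>e\<close>.\<close>
      have "?c = x - d" by (simp add: d_def)
      then have eq: "act m e ?c + d - act m (\<lambda>i. u (e i)) B
          = act m e (x - act m u B) - act m e d + d"
        unfolding act_u by (simp add: act_diff)
      have "top_part n d = 0"
        by (rule poly_mapping_eqI) (simp add: d_def lookup_top_part lookup_minus)
      then have top: "top_part n (act m e ?c + d - act m (\<lambda>i. u (e i)) B) = 0"
        unfolding eq top_part_diff[of n "_ - _"] top_part_diff[of n "act m e _"] top_part_add
        using top_part_act_eq_0[OF ZD(2), of e m] em less.prems(4)
          top_part_act_eq_0[OF ZDelta_diff[OF x(1) ZD(3)], of e m]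
        by simp
      have "gen m n (act m e ?c + d)"
        using small w top less.prems(2,3) mono_e em[of m]
        by (intro less.hyps[of "\<lambda>i. u (e i)"]) (auto simp: mono_def intro: order_trans)
      then show "gen m n (act m (\<lambda>k. if k = t then t - 1 else k) ?c + (x - ?c))"
        by (simp add: e_def d_def)
    qed
  qed
qed

text \<open>Both recursive appeals lower \<open>m + n\<close>. Starting from the identity as
  \<open>u\<close> and \<open>x\<close> itself as \<open>B\<close>, the factorisation condition is
  trivial.\<close>

lemma Orient_imp_gen: "x \<in> Orient m n \<Longrightarrow> gen m n x"
proof (induction "m + n" arbitrary: m n x rule: less_induct)
  case less
  then show ?case
    by (intro gen_if_top_part_factors[of m n x x "\<lambda>i. i"])
       (auto simp: Orient_iff mono_def act_id top_part_def)
qed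

theorem theorem5p14:
  "closed_family Orient \<and> (\<forall>S. closed_family S \<longrightarrow> (\<forall>m n. Orient m n \<subseteq> S m n))"
  using closed_family_Orient gen_in_closed_family Orient_imp_gen by blast

end
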